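(* Let $F$, $K$, $t$ be as in the context. Let $a_1,a_2\in F$, $n_1,n_2\in\mathbb{Z}$ and $h\in F[X]$ be data whose depth is non-negative. Then for every Schwartz–Bruhat function $f$ on $K\times K$, with $g=f^{(a_1,a_2),(n_1,n_2)}$, the function $\Phi(x,y)=g(x,y-h(x))$ is Fubini on $F\times F$ with repeated integral $\int_K\int_Kf(u,v)\,du\,dv\,X^{n_1+n_2}$.
   Context: $F$ is a complete discrete valuation field with ring of integers $\mathcal{O}_F$, fixed uniformizer $t$, valuation $\nu$, residue map $x\mapsto\bar{x}$, and residue field $K$ a local field ($\mathbb{R}$, $\mathbb{C}$ or non-archimedean); a Haar measure on $K$ is fixed. For a complex Haar integrable $f$ on $K$, $a\in F$, $n\in\mathbb{Z}$: $f^0(x)=f(\bar{x})$ for $x\in\mathcal{O}_F$ and $0$ otherwise, and the lift $f^{a,n}$ is defined by $f^{a,n}(a+t^nx)=f^0(x)$. The integrable functions on $F$ form the $\mathbb{C}(X)$-span $\mathcal{L}(F)$ of all such lifts; $\int^F$ is the unique $\mathbb{C}(X)$-linear functional on $\mathcal{L}(F)$ with $\int^Ff^0=\int_Kf$, translation invariance, and $\int^Fg(\alpha x)dx=|\alpha|^{-1}\int^Fg$, where $|\alpha|=|\overline{\alpha t^{-\nu(\alpha)}}|_KX^{\nu(\alpha)}$; in particular $\int^Ff^{a,n}=(\int_Kf)X^n$. $\Phi:F\times F\to\mathbb{C}(X)$ is Fubini if all its horizontal and vertical sections are integrable, both resulting functions of the remaining variable are integrable, and the two repeated integrals agree. For $f$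 on $K\times K$: $f^0(x,y)=f(\bar{x},\bar{y})$ for $x,y\in\mathcal{O}_F$, else $0$; $f^{(a_1,a_2),(n_1,n_2)}(a_1+t^{n_1}x,a_2+t^{n_2}y)=f^0(x,y)$. Schwartz–Bruhat: smooth of rapid decay ($K$ archimedean) or locally constant of compact support ($K$ non-archimedean). Depth of data $a_1,a_2,n_1,n_2,h$ ($h$ non-constant): write $h(a_1+t^{n_1}X)=h(a_1)+t^{R'}q(X)$ with $R'\in\mathbb{Z}$, $q\in\mathcal{O}_F[X]$ with non-zero image in $K[X]$; the depth is $R'-n_2$. *)

theory Defs
  imports "HOL-Analysis.Analysis" "HOL-Computational_Algebra.Polynomial"
          "HOL-Computational_Algebra.Fraction_Field"
begin

type_synonym CX = "complex poly fract"

definition cconst :: "complex \<Rightarrow> CX" where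
  "cconst c = Fract [:c:] 1"

definition Xf :: CX where
  "Xf = Fract [:0, 1:] 1"

text \<open>The valuation nu is only meaningful on non-zero elements.\<close>
definition vring :: "('f::field \<Rightarrow> int) \<Rightarrow> 'f set" where
  "vring \<nu> = {x. x = 0 \<or> 0 \<le> \<nu> x}"

definition cdvf :: "('f::field \<Rightarrow> int) \<Rightarrow> 'f \<Rightarrow> ('f \<Rightarrow> 'k::field) \<Rightarrow> bool" where
  "cdvf \<nu> t res \<longleftrightarrow>
     (\<forall>x y. x \<noteq> 0 \<and> y \<noteq> 0 \<longrightarrow> \<nu> (x * y) = \<nu> x + \<nu> y) \<and>
     (\<forall>x y. x \<noteq> 0 \<and> y \<noteq> 0 \<and> x + y \<noteq> 0 \<longrightarrow> min (\<nu> x) (\<nu> y) \<le> \<nu> (x + y)) \<and>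
     t \<noteq> 0 \<and> \<nu> t = 1 \<and>
     (\<forall>x\<in>vring \<nu>. \<forall>y\<in>vring \<nu>. res (x + y) = res x + res y \<and> res (x * y) = res x * res y) \<and>
     res 1 = 1 \<and>
     res ` vring \<nu> = UNIV \<and>
     (\<forall>x\<in>vring \<nu>. res x = 0 \<longleftrightarrow> (x = 0 \<or> 1 \<le> \<nu> x)) \<and>
     (\<forall>s :: nat \<Rightarrow> 'f.
        (\<forall>M. \<exists>N. \<forall>m n. N \<le> m \<and> N \<le> n \<longrightarrow> s m = s n \<or> M \<le> \<nu> (s m - s n)) \<longrightarrow>
        (\<exists>L. \<forall>M. \<exists>N. \<forall>n. N \<le> n \<longrightarrow> s n = L \<or> M \<le> \<nu> (s n - L)))"

definition local_field :: "'k::{field, t2_space} itself \<Rightarrow> bool" where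
  "local_field _ \<longleftrightarrow>
     continuous_on UNIV (\<lambda>p::'k \<times> 'k. fst p + snd p) \<and>
     continuous_on UNIV (\<lambda>p::'k \<times> 'k. fst p * snd p) \<and>
     continuous_on UNIV (\<lambda>x::'k. - x) \<and>
     continuous_on (- {0}) (\<lambda>x::'k. inverse x) \<and>
     locally compact (UNIV :: 'k set) \<and>
     (\<forall>x::'k. \<not> open {x})"

definition haar_measure :: "'k::{field, t2_space} measure \<Rightarrow> bool" where
  "haar_measure \<mu> \<longleftrightarrow>
     sets \<mu> = sets borel \<and>
     (\<forall>A\<in>sets borel. \<forall>a. emeasure \<mu> ((+) a ` A) = emeasure \<mu> A) \<and>
     (\<forall>C. compact C \<longrightarrow> emeasure \<mu> C < \<infinity>) \<and>
     (\<forall>U. open U \<and> U \<noteq> {} \<longrightarrow> 0 < emeasure \<mu> U)"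

fun ddiff :: "'a list \<Rightarrow> ('a::real_normed_vector \<Rightarrow> 'b::real_normed_vector) \<Rightarrow> 'a \<Rightarrow> 'b" where
  "ddiff [] g = g"
| "ddiff (v # vs) g = (\<lambda>x. frechet_derivative (ddiff vs g) (at x) v)"

definition schwartz :: "('a::euclidean_space \<Rightarrow> complex) \<Rightarrow> bool" where
  "schwartz g \<longleftrightarrow>
     (\<forall>vs x. ddiff vs g differentiable (at x)) \<and>
     (\<forall>vs (N::nat). \<exists>C. \<forall>x. (1 + norm x) ^ N * norm (ddiff vs g x) \<le> C)"

definition top_field_iso :: "('k::{field, topological_space} \<Rightarrow> 'r::{field, topological_space}) \<Rightarrow> bool" where
  "top_field_iso \<phi> \<longleftrightarrow> bij \<phi> \<and> continuous_on UNIV \<phi> \<and> continuous_on UNIV (inv \<phi>) \<and>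
     (\<forall>x y. \<phi> (x + y) = \<phi> x + \<phi> y \<and> \<phi> (x * y) = \<phi> x * \<phi> y)"

text \<open>K archimedean (connected, i.e. isomorphic to R or C): smooth of rapid decay via an
  identification with R or C; K non-archimedean: locally constant of compact support.\<close>
definition schwartz_bruhat :: "('k::{field, t2_space} \<times> 'k \<Rightarrow> complex) \<Rightarrow> bool" where
  "schwartz_bruhat f \<longleftrightarrow>
     (if connected (UNIV :: 'k set) then
        (\<exists>\<phi> :: 'k \<Rightarrow> real. top_field_iso \<phi> \<and>
            schwartz (\<lambda>p :: real \<times> real. f (inv \<phi> (fst p), inv \<phi> (snd p)))) \<or>
        (\<exists>\<phi> :: 'k \<Rightarrow> complex. top_field_iso \<phi> \<and>
            schwartz (\<lambda>p :: complex \<times> complex. f (inv \<phi> (fst p), inv \<phi> (snd p))))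
      else
        (\<forall>z. \<exists>U. open U \<and> z \<in> U \<and> (\<forall>w\<in>U. f w = f z)) \<and>
        (\<exists>C. compact C \<and> (\<forall>z. f z \<noteq> 0 \<longrightarrow> z \<in> C)))"

definition lift0 :: "('f::field \<Rightarrow> int) \<Rightarrow> ('f \<Rightarrow> 'k) \<Rightarrow> ('k \<Rightarrow> complex) \<Rightarrow> 'f \<Rightarrow> complex" where
  "lift0 \<nu> res f x = (if x \<in> vring \<nu> then f (res x) else 0)"

text \<open>f^{a,n}(a + t^n x) = f^0(x)\<close>
definition lift :: "('f::field \<Rightarrow> int) \<Rightarrow> 'f \<Rightarrow> ('f \<Rightarrow> 'k) \<Rightarrow> ('k \<Rightarrow> complex) \<Rightarrow> 'f \<Rightarrow> int \<Rightarrow> 'f \<Rightarrow> complex" where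
  "lift \<nu> t res f a n x = lift0 \<nu> res f ((x - a) / t powi n)"

definition lift0_2 :: "('f::field \<Rightarrow> int) \<Rightarrow> ('f \<Rightarrow> 'k) \<Rightarrow> ('k \<times> 'k \<Rightarrow> complex) \<Rightarrow> 'f \<Rightarrow> 'f \<Rightarrow> complex" where
  "lift0_2 \<nu> res f x y = (if x \<in> vring \<nu> \<and> y \<in> vring \<nu> then f (res x, res y) else 0)"

text \<open>f^{(a1,a2),(n1,n2)}(a1 + t^n1 x, a2 + t^n2 y) = f^0(x,y)\<close>
definition lift2 :: "('f::field \<Rightarrow> int) \<Rightarrow> 'f \<Rightarrow> ('f \<Rightarrow> 'k) \<Rightarrow> ('k \<times> 'k \<Rightarrow> complex)
      \<Rightarrow> 'f \<Rightarrow> 'f \<Rightarrow> int \<Rightarrow> int \<Rightarrow> 'f \<Rightarrow> 'f \<Rightarrow> complex" where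
  "lift2 \<nu> t res f a1 a2 n1 n2 x y =
     lift0_2 \<nu> res f ((x - a1) / t powi n1) ((y - a2) / t powi n2)"

definition F_rep :: "('f::field \<Rightarrow> int) \<Rightarrow> 'f \<Rightarrow> ('f \<Rightarrow> 'k::{field, t2_space}) \<Rightarrow> 'k measure
      \<Rightarrow> ('f \<Rightarrow> CX) \<Rightarrow> (CX \<times> ('k \<Rightarrow> complex) \<times> 'f \<times> int) list \<Rightarrow> bool" where
  "F_rep \<nu> t res \<mu> g R \<longleftrightarrow>
     (\<forall>(r, f, a, n) \<in> set R. integrable \<mu> f) \<and>
     g = (\<lambda>x. \<Sum>(r, f, a, n) \<leftarrow> R. r * cconst (lift \<nu> t res f a n x))"

definition rep_val :: "'k::{field, t2_space} measure \<Rightarrow> (CX \<times> ('k \<Rightarrow> complex) \<times> 'f \<times> int) list \<Rightarrow> CX" where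
  "rep_val \<mu> R = (\<Sum>(r, f, a, n) \<leftarrow> R. r * cconst (LINT u|\<mu>. f u) * Xf powi n)"

text \<open>g lies in L(F) and its integral is c (the value of the C(X)-linear functional
  determined by int f^{a,n} = (int_K f) X^n).\<close>
definition has_integral_F :: "('f::field \<Rightarrow> int) \<Rightarrow> 'f \<Rightarrow> ('f \<Rightarrow> 'k::{field, t2_space}) \<Rightarrow> 'k measure
      \<Rightarrow> ('f \<Rightarrow> CX) \<Rightarrow> CX \<Rightarrow> bool" where
  "has_integral_F \<nu> t res \<mu> g c \<longleftrightarrow>
     (\<exists>R. F_rep \<nu> t res \<mu> g R) \<and> (\<forall>R. F_rep \<nu> t res \<mu> g R \<longrightarrow> rep_val \<mu> R = c)"

definition fubini_F :: "('f::field \<Rightarrow> int) \<Rightarrow> 'f \<Rightarrow> ('f \<Rightarrow> 'k::{field, t2_space}) \<Rightarrow> 'k measure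
      \<Rightarrow> ('f \<Rightarrow> 'f \<Rightarrow> CX) \<Rightarrow> CX \<Rightarrow> bool" where
  "fubini_F \<nu> t res \<mu> \<Phi> I \<longleftrightarrow>
     (\<exists>Iy Ix.
        (\<forall>x. has_integral_F \<nu> t res \<mu> (\<lambda>y. \<Phi> x y) (Iy x)) \<and>
        (\<forall>y. has_integral_F \<nu> t res \<mu> (\<lambda>x. \<Phi> x y) (Ix y)) \<and>
        has_integral_F \<nu> t res \<mu> Iy I \<and>
        has_integral_F \<nu> t res \<mu> Ix I)"

end

theory Submission
  imports Defs
begin

text \<open>Fubini for \<open>\<Phi>\<close> reduces to Fubini on \<open>K\<close>. On the support of \<open>\<Phi>\<close> write \<open>x = a1 + t^n1 x'\<close>; non-negative
  depth makes \<open>(h x - h a1) / t^n2\<close> integral, with residue a polynomial \<open>p\<close> in the residue of \<open>x'\<close>.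
  Hence all sections of \<open>\<Phi>\<close> are lifts of sections of \<open>(u, v) \<mapsto> f (u, v - p u)\<close>, and shearing does not
  affect integrals on \<open>K \<times> K\<close>.

  That the integral on \<open>F\<close> is independent of the representation by lifts comes from the fact that \<open>K\<close>
  has infinite measure: on a coset of the deepest level of a vanishing combination, the terms
  attached to it sum to a constant integrable function, which must be zero.\<close>

section \<open>Haar measure on a local field\<close>

locale haar_local_field =
  fixes \<mu> :: "'k::{field, t2_space} measure"
  assumes K: "local_field TYPE('k)" and haar: "haar_measure \<mu>"
begin

lemma sets_mu [simp, measurable_cong]: "sets \<mu> = sets borel"
  using haar by (simp add: haar_measure_def)

lemma space_mu [simp]: "space \<mu> = UNIV"
  using sets_eq_imp_space_eq[OF sets_mu] by simp

lemma emeasure_translate: "A \<in> sets borel \<Longrightarrow> emeasure \<mu> ((+) a ` A) = emeasure \<mu> A"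
  using haar by (simp add: haar_measure_def)

lemma emeasure_compact_finite: "compact C \<Longrightarrow> emeasure \<mu> C < \<infinity>"
  using haar by (simp add: haar_measure_def)

lemma emeasure_open_pos: "open U \<Longrightarrow> U \<noteq> {} \<Longrightarrow> 0 < emeasure \<mu> U"
  using haar by (simp add: haar_measure_def)

section \<open>Continuity of the field operations and topology of translates\<close>

lemma field_continuous_on_add:
  fixes f g :: "'a::topological_space \<Rightarrow> 'k"
  assumes "continuous_on S f" "continuous_on S g"
  shows "continuous_on S (\<lambda>x. f x + g x)"
proof -
  have "continuous_on UNIV (\<lambda>p::'k \<times> 'k. fst p + snd p)"
    using K by (simp add: local_field_def)
  from continuous_on_compose2[OF this continuous_on_Pair[OF assms]] show ?thesis by simp
qed

lemma field_continuous_on_mult: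
  fixes f g :: "'a::topological_space \<Rightarrow> 'k"
  assumes "continuous_on S f" "continuous_on S g"
  shows "continuous_on S (\<lambda>x. f x * g x)"
proof -
  have "continuous_on UNIV (\<lambda>p::'k \<times> 'k. fst p * snd p)"
    using K by (simp add: local_field_def)
  from continuous_on_compose2[OF this continuous_on_Pair[OF assms]] show ?thesis by simp
qed

lemma field_continuous_on_minus:
  fixes f :: "'a::topological_space \<Rightarrow> 'k"
  assumes "continuous_on S f"
  shows "continuous_on S (\<lambda>x. - f x)"
proof -
  have "continuous_on UNIV (\<lambda>x::'k. - x)"
    using K by (simp add: local_field_def)
  from continuous_on_compose2[OF this assms] show ?thesis by simp
qed

lemma field_continuous_on_diff:
  fixes f g :: "'a::topological_space \<Rightarrow> 'k"
  assumes "continuous_on S f" "continuous_on S g"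
  shows "continuous_on S (\<lambda>x. f x - g x)"
  using field_continuous_on_add[OF assms(1) field_continuous_on_minus[OF assms(2)]] by simp

lemma open_translate:
  fixes U :: "'k set"
  assumes "open U"
  shows "open ((+) a ` U)"
proof -
  have "(+) a ` U = (\<lambda>x. x - a) -` U"
    by (auto intro!: image_eqI[where x="x - a" for x])
  then show ?thesis
    using assms by (simp add: open_vimage field_continuous_on_diff)
qed

lemma compact_translate:
  fixes C :: "'k set"
  assumes "compact C"
  shows "compact ((+) a ` C)"
  using assms by (intro compact_continuous_image field_continuous_on_add continuous_intros)

text \<open>In a compact field the closed hyperbola \<open>G\<close> would be compact, hence so
  would its projection, the set of non-zero elements. That set would then be closed and
  \<open>{0}\<close> open, against non-discreteness.\<close>

lemma not_compact_UNIV: "\<not> compact (UNIV :: 'k set)"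
proof
  assume c: "compact (UNIV :: 'k set)"
  have no: "\<not> open {0::'k}"
    using K by (simp add: local_field_def)
  have prod: "continuous_on UNIV (\<lambda>p::'k \<times> 'k. fst p * snd p)"
    using K by (simp add: local_field_def)
  define G where "G = {p::'k \<times> 'k. fst p * snd p = 1}"
  have "G = (\<lambda>p::'k \<times> 'k. fst p * snd p) -` {1}"
    by (auto simp: G_def)
  then have "closed G"
    using closed_vimage[OF closed_singleton prod] by simp
  moreover have "compact (UNIV :: ('k \<times> 'k) set)"
    using compact_Times[OF c c] by simp
  ultimately have "compact G"
    using compact_Int_closed[of UNIV G] by simp
  then have "compact (fst ` G)"
    by (intro compact_continuous_image continuous_intros)
  moreover have "fst ` G = - {0}"
  proof -
    have "x \<in> fst ` G" if "x \<noteq> 0" for x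
      using that by (intro image_eqI[where x="(x, inverse x)"]) (auto simp: G_def)
    then show ?thesis by (auto simp: G_def)
  qed
  ultimately show False
    using no compact_imp_closed[of "- {0::'k}"] by (simp add: closed_def)
qed

text \<open>If the measure were finite, finitely many disjoint translates of a small open set would be
  a maximal packing, and thickening them would cover the field by finitely many compact sets.\<close>
lemma emeasure_UNIV: "emeasure \<mu> UNIV = \<infinity>"
proof (rule ccontr)
  assume "emeasure \<mu> UNIV \<noteq> \<infinity>"
  then have fin: "emeasure \<mu> UNIV < \<infinity>" by (simp add: less_top)
  have "locally compact (UNIV :: 'k set)" using K by (simp add: local_field_def)
  then obtain U V :: "'k set" where UV: "open U" "compact V" "0 \<in> U" "U \<subseteq> V"
    unfolding locally_def by (metis UNIV_I open_UNIV openin_open_eq subtopology_UNIV open_openin)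
  \<comment> \<open>Continuity of subtraction yields a neighbourhood \<open>W\<close> of 0 whose
    differences lie in \<open>U\<close>. If the translates of \<open>W\<close> by \<open>x\<close>
    and \<open>y\<close> meet, then \<open>y\<close> lies in the translate of \<open>V\<close> by
    \<open>x\<close>.\<close>
  have "open ((\<lambda>p::'k\<times>'k. fst p - snd p) -` U)"
    using UV by (intro open_vimage field_continuous_on_diff continuous_intros)
  moreover have "(0,0) \<in> (\<lambda>p::'k\<times>'k. fst p - snd p) -` U" using UV by simp
  ultimately obtain W1 W2 where W12: "open W1" "open W2" "(0,0) \<in> W1 \<times> W2"
      "W1 \<times> W2 \<subseteq> (\<lambda>p::'k\<times>'k. fst p - snd p) -` U"
    by (rule open_prod_elim)
  define W where "W = W1 \<inter> W2"
  have W: "open W" "0 \<in> W" and WU: "\<And>x y. x \<in> W \<Longrightarrow> y \<in> W \<Longrightarrow> x - y \<in> U"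
    using W12 by (auto simp: W_def)
  define c where "c = emeasure \<mu> W"
  have c0: "c > 0" using emeasure_open_pos W by (auto simp: c_def)
  have c1: "c < \<infinity>" unfolding c_def
    by (rule le_less_trans[OF emeasure_mono fin]) auto
  define pack where
    "pack = (\<lambda>X::'k set. finite X \<and> disjoint_family_on (\<lambda>x. (+) x ` W) X)"
  have bound: "of_nat (card X) * c \<le> emeasure \<mu> UNIV" if "pack X" for X
  proof -
    have "of_nat (card X) * c = (\<Sum>x\<in>X. emeasure \<mu> ((+) x ` W))"
      using W by (simp add: emeasure_translate c_def)
    also have "\<dots> = emeasure \<mu> (\<Union>x\<in>X. (+) x ` W)"
      using that W by (intro sum_emeasure) (auto simp: pack_def open_translate)
    also have "\<dots> \<le> emeasure \<mu> UNIV" by (intro emeasure_mono) auto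
    finally show ?thesis .
  qed
  have "emeasure \<mu> UNIV / c < top"
    using fin c0 by (auto simp: ennreal_divide_eq_top_iff less_top[symmetric])
  then obtain n where n: "emeasure \<mu> UNIV / c < of_nat n"
    using ennreal_Ex_less_of_nat by blast
  have "card X < n" if "pack X" for X
  proof -
    have "of_nat (card X) \<le> emeasure \<mu> UNIV / c"
      using bound[OF that] c0 c1
      by (metis divide_less_ennreal infinity_ennreal_def linorder_not_less not_gr_zero)
    then show ?thesis using n by (metis le_less_trans of_nat_less_iff)
  qed
  then obtain X where X: "pack X" and max: "\<And>Y. pack Y \<Longrightarrow> card Y \<le> card X"
    using ex_has_greatest_nat[of pack "{}" card n] by (auto simp: pack_def disjoint_family_on_def less_imp_le)
  have "UNIV \<subseteq> (\<Union>x\<in>X. (+) x ` V)"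
  proof
    fix y :: 'k
    show "y \<in> (\<Union>x\<in>X. (+) x ` V)"
    proof (cases "y \<in> X")
      case True
      then show ?thesis using UV by force
    next
      case False
      then have "card (insert y X) > card X" using X by (simp add: pack_def)
      then have "\<not> pack (insert y X)" using max by (meson not_le)
      then obtain x where "x \<in> X" "(+) x ` W \<inter> (+) y ` W \<noteq> {}"
        using X False by (auto simp: pack_def disjoint_family_on_insert)
      then obtain a b where ab: "a \<in> W" "b \<in> W" "x + a = y + b" by blast
      then have "y = x + (a - b)" by (simp add: algebra_simps)
      then show ?thesis using WU[of a b] ab UV \<open>x \<in> X\<close> by blast
    qed
  qed
  moreover have "compact (\<Union>x\<in>X. (+) x ` V)"
    using X UV by (intro compact_UN) (auto simp: pack_def compact_translate)
  ultimately show False using not_compact_UNIV by (simp add: top.extremum_unique)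
qed

text \<open>This is the form in which the infinite measure of \<open>K\<close> enters the uniqueness
  of the integral on \<open>F\<close>.\<close>

lemma integrable_const_iff_zero: "integrable \<mu> (\<lambda>_. c :: complex) \<Longrightarrow> c = 0"
  by (rule ccontr) (simp add: integrable_iff_bounded emeasure_UNIV ennreal_mult_top)

section \<open>Translation invariance of integrals\<close>

lemma measurable_translate: "(\<lambda>x. x + a) \<in> measurable \<mu> \<mu>"
proof -
  have "(\<lambda>x::'k. x + a) \<in> borel_measurable borel"
    by (intro borel_measurable_continuous_onI field_continuous_on_add continuous_intros)
  then show ?thesis by (simp cong: measurable_cong_sets)
qed

lemma distr_translate: "distr \<mu> \<mu> (\<lambda>x. x + a) = \<mu>"
proof (rule measure_eqI)
  fix A assume "A \<in> sets (distr \<mu> \<mu> (\<lambda>x. x + a))"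
  then have A: "A \<in> sets borel" by simp
  have "(\<lambda>x. x + a) -` A = (+) (- a) ` A"
    by (auto intro!: image_eqI[where x="x + a" for x])
  then show "emeasure (distr \<mu> \<mu> (\<lambda>x. x + a)) A = emeasure \<mu> A"
    using A by (simp only: emeasure_distr[OF measurable_translate] emeasure_translate sets_mu space_mu Int_UNIV_right)
qed simp

lemma integrable_translate:
  fixes f :: "'k \<Rightarrow> complex"
  shows "integrable \<mu> f \<Longrightarrow> integrable \<mu> (\<lambda>x. f (x + a))"
  using integrable_distr[OF measurable_translate[of a], of f] by (simp add: distr_translate)

lemma integral_translate:
  fixes f :: "'k \<Rightarrow> complex"
  assumes "integrable \<mu> f"
  shows "(LINT x|\<mu>. f (x + a)) = (LINT x|\<mu>. f x)"
  using integral_distr[OF measurable_translate[of a], of f] assms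
  by (simp add: distr_translate borel_measurable_integrable)

lemma nn_integral_translate:
  assumes "f \<in> borel_measurable \<mu>"
  shows "(\<integral>\<^sup>+x. f (x + a) \<partial>\<mu>) = (\<integral>\<^sup>+x. f x \<partial>\<mu>)"
  using nn_integral_distr[OF measurable_translate[of a], of f] assms by (simp add: distr_translate)

end

section \<open>Fubini for sheared Schwartz--Bruhat functions\<close>

context haar_local_field
begin

text \<open>Every section must be integrable, not merely almost every one, because
  \<open>fubini_F\<close> quantifies over all points of \<open>F\<close>. Only repeated integrals
  occur, so the notion makes sense without a product measure.\<close>

definition fubini_on :: "('k \<Rightarrow> 'k \<Rightarrow> complex) \<Rightarrow> bool" where
  "fubini_on H \<longleftrightarrow>
     (\<forall>u. integrable \<mu> (H u)) \<and> (\<forall>v. integrable \<mu> (\<lambda>u. H u v)) \<and>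
     integrable \<mu> (\<lambda>u. LINT v|\<mu>. H u v) \<and> integrable \<mu> (\<lambda>v. LINT u|\<mu>. H u v) \<and>
     (LINT u|\<mu>. LINT v|\<mu>. H u v) = (LINT v|\<mu>. LINT u|\<mu>. H u v)"

section \<open>Locally constant functions of compact support\<close>

lemma fubini_on_sum_boxes:
  fixes c :: "'i \<Rightarrow> complex"
  assumes H: "\<And>u v. H u v = (\<Sum>j\<in>J. c j * (indicator (A j) u * indicator (B j) v))"
    and A: "\<And>j. j \<in> J \<Longrightarrow> A j \<in> sets borel \<and> emeasure \<mu> (A j) < \<infinity>"
    and B: "\<And>j. j \<in> J \<Longrightarrow> B j \<in> sets borel \<and> emeasure \<mu> (B j) < \<infinity>"
  shows "fubini_on H"
proof -
  have ind: "integrable \<mu> (\<lambda>x. indicator S x :: complex)"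
       "(LINT x|\<mu>. (indicator S x :: complex)) = measure \<mu> S"
    if "S \<in> sets borel \<and> emeasure \<mu> S < \<infinity>" for S
  proof -
    have "has_bochner_integral \<mu> (indicator S :: 'k \<Rightarrow> real) (measure \<mu> S)"
      using that by (intro has_bochner_integral_real_indicator) auto
    then have "has_bochner_integral \<mu> (\<lambda>x. complex_of_real (indicator S x)) (measure \<mu> S)"
      by (rule has_bochner_integral_of_real)
    moreover have "(\<lambda>x. complex_of_real (indicator S x)) = indicator S"
      by (auto simp: indicator_def)
    ultimately show "integrable \<mu> (\<lambda>x. indicator S x :: complex)"
       "(LINT x|\<mu>. (indicator S x :: complex)) = measure \<mu> S"
      by (auto simp: has_bochner_integral_iff)
  qed
  have H': "H = (\<lambda>u v. \<Sum>j\<in>J. c j * (indicator (A j) u * indicator (B j) v))"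
    using H by blast
  have intA: "integrable \<mu> (\<lambda>u. c j * (indicator (A j) u * x))" if "j \<in> J" for j x
    using ind(1)[OF A[OF that]] by (intro integrable_mult_right integrable_mult_left)
  have intB: "integrable \<mu> (\<lambda>v. c j * (x * indicator (B j) v))" if "j \<in> J" for j x
    using ind(1)[OF B[OF that]] by (intro integrable_mult_right)
  define a b where "a j = complex_of_real (measure \<mu> (A j))"
    and "b j = complex_of_real (measure \<mu> (B j))" for j
  have valA: "(LINT u|\<mu>. c j * (indicator (A j) u * x)) = c j * (a j * x)" if "j \<in> J" for j x
    using ind(2)[OF A[OF that]] by (simp add: a_def)
  have valB: "(LINT v|\<mu>. c j * (x * indicator (B j) v)) = c j * (x * b j)" if "j \<in> J" for j x
    using ind(2)[OF B[OF that]] by (simp add: b_def)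
  have 1: "(LINT v|\<mu>. H u v) = (\<Sum>j\<in>J. c j * (indicator (A j) u * b j))" for u
    unfolding H' by (subst Bochner_Integration.integral_sum) (intro intB sum.cong refl valB; assumption)+
  have 2: "(LINT u|\<mu>. H u v) = (\<Sum>j\<in>J. c j * (a j * indicator (B j) v))" for v
    unfolding H' by (subst Bochner_Integration.integral_sum) (intro intA sum.cong refl valA; assumption)+
  \<comment> \<open>A box contributes the product of the measures of its sides in either order, so
    the two repeated integrals are evaluated to the same explicit sum.\<close>
  have 3: "(LINT u|\<mu>. LINT v|\<mu>. H u v) = (\<Sum>j\<in>J. c j * (a j * b j))"
    unfolding 1 by (subst Bochner_Integration.integral_sum) (intro intA sum.cong refl valA; assumption)+
  have 4: "(LINT v|\<mu>. LINT u|\<mu>. H u v) = (\<Sum>j\<in>J. c j * (a j * b j))"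
    unfolding 2 by (subst Bochner_Integration.integral_sum) (intro intB sum.cong refl valB; assumption)+
  have "integrable \<mu> (H u)" "integrable \<mu> (\<lambda>u. H u v)" for u v
    unfolding H' by (rule Bochner_Integration.integrable_sum, (erule intA | erule intB))+
  moreover have "integrable \<mu> (\<lambda>u. LINT v|\<mu>. H u v)"
    unfolding 1 by (rule Bochner_Integration.integrable_sum, erule intA)
  moreover have "integrable \<mu> (\<lambda>v. LINT u|\<mu>. H u v)"
    unfolding 2 by (rule Bochner_Integration.integrable_sum, erule intB)
  ultimately show ?thesis
    unfolding fubini_on_def using 3 4 by simp
qed

text \<open>Finitely many open rectangles on which \<open>f\<close> is constant cover the support.
  The value \<open>f (u, v)\<close> depends only on which first sides contain \<open>u\<close> and
  which second sides contain \<open>v\<close>; grouping points by these two patterns writes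
  \<open>f\<close> as a finite combination of boxes.\<close>

lemma fubini_on_locally_constant:
  assumes lc: "\<And>z :: 'k \<times> 'k. \<exists>U. open U \<and> z \<in> U \<and> (\<forall>w\<in>U. f w = f z)"
    and C: "compact C" "\<And>z. f z \<noteq> 0 \<Longrightarrow> z \<in> C"
  shows "fubini_on (\<lambda>u v. f (u, v))"
proof -
  have "\<exists>A B. open A \<and> open B \<and> z \<in> A \<times> B \<and> (\<forall>w\<in>A \<times> B. f w = f z)" for z
  proof -
    obtain U where U: "open U" "z \<in> U" "\<forall>w\<in>U. f w = f z" using lc by blast
    obtain A B where "open A" "open B" "z \<in> A \<times> B" "A \<times> B \<subseteq> U"
      by (rule open_prod_elim[OF U(1,2)])
    then show ?thesis using U by blast
  qed
  then obtain A0 B0 where AB0: "\<And>z. open (A0 z)" "\<And>z. open (B0 z)" "\<And>z. z \<in> A0 z \<times> B0 z"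
      "\<And>z w. w \<in> A0 z \<times> B0 z \<Longrightarrow> f w = f z"
    by metis
  have "C \<subseteq> (\<Union>z\<in>C. A0 z \<times> B0 z)" using AB0(3) by blast
  then obtain D where D: "D \<subseteq> C" "finite D" "C \<subseteq> (\<Union>z\<in>D. A0 z \<times> B0 z)"
    by (rule compactE_image[OF C(1) open_Times[OF AB0(1,2)]])
  have cpt: "compact (fst ` C)" "compact (snd ` C)"
    using C(1) by (auto intro!: compact_continuous_image continuous_intros)
  \<comment> \<open>The sides are cut down to the projections of \<open>C\<close>, so that a
    non-empty pattern confines its points to a compact set and hence to finite measure.\<close>
  define S where "S u = {z \<in> D. u \<in> A0 z \<inter> fst ` C}" for u
  define T where "T v = {z \<in> D. v \<in> B0 z \<inter> snd ` C}" for v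
  \<comment> \<open>A common index \<open>z\<close> of the two patterns names a rectangle through
    \<open>(u, v)\<close>, where \<open>f\<close> equals \<open>f z\<close>; any choice of
    \<open>z\<close> will do. With no common index, \<open>(u, v)\<close> lies outside
    \<open>C\<close>, which explains the default 0.\<close>
  define val where "val = (\<lambda>(P, Q). if P \<inter> Q = {} then 0 else f (SOME z. z \<in> P \<inter> Q))"
  have f_val: "f (u, v) = val (S u, T v)" for u v
  proof (cases "S u \<inter> T v = {}")
    case True
    have "f (u, v) = 0"
    proof (rule ccontr)
      assume "f (u, v) \<noteq> 0"
      then have "(u, v) \<in> C" by (rule C(2))
      moreover from this obtain z where "z \<in> D" "(u, v) \<in> A0 z \<times> B0 z" using D by blast
      ultimately have "z \<in> S u \<inter> T v" by (auto simp: S_def T_def intro: rev_image_eqI)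
      then show False using True by blast
    qed
    then show ?thesis using True by (simp add: val_def)
  next
    case False
    define z where "z = (SOME z. z \<in> S u \<inter> T v)"
    have "z \<in> S u \<inter> T v" using False unfolding z_def by (metis some_in_eq)
    then have "f (u, v) = f z" using AB0(4)[of "(u, v)" z] by (auto simp: S_def T_def)
    then show ?thesis using False by (simp add: val_def z_def)
  qed
  \<comment> \<open>Empty patterns are left out because their level sets are complements that may
    have infinite measure; \<open>val\<close> is 0 on them.\<close>
  define J where "J = (Pow D - {{}}) \<times> (Pow D - {{}})"
  have fin: "finite J" using D by (simp add: J_def)
  have meas: "{u. {z \<in> D. u \<in> E z \<inter> G} = P} \<in> sets borel \<and>
      emeasure \<mu> {u. {z \<in> D. u \<in> E z \<inter> G} = P} < \<infinity>"
    if "\<And>z. open (E z)" "compact G" "P \<in> Pow D - {{}}" for E :: "_ \<Rightarrow> 'k set" and G P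
  proof -
    have b: "E z \<inter> G \<in> sets borel" for z
      by (rule sets.Int[OF borel_open[OF that(1)] borel_closed[OF compact_imp_closed[OF that(2)]]])
    have P: "P \<subseteq> D" "P \<noteq> {}" using that(3) by auto
    have "{u. {z \<in> D. u \<in> E z \<inter> G} = P} =
        (\<Inter>z\<in>P. E z \<inter> G) - (\<Union>z\<in>D - P. E z \<inter> G)"
      using P by blast
    also have "\<dots> \<in> sets borel"
      using P b D(2) finite_subset[OF P(1)]
      by (intro sets.Diff sets.finite_INT sets.finite_UN) auto
    finally have "{u. {z \<in> D. u \<in> E z \<inter> G} = P} \<in> sets borel" .
    moreover have "emeasure \<mu> {u. {z \<in> D. u \<in> E z \<inter> G} = P} \<le> emeasure \<mu> G"
      using P borel_closed[OF compact_imp_closed[OF that(2)]] by (intro emeasure_mono) auto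
    ultimately show ?thesis using emeasure_compact_finite[OF that(2)] by (blast intro: le_less_trans)
  qed
  have measS: "{u. S u = P} \<in> sets borel \<and> emeasure \<mu> {u. S u = P} < \<infinity>"
    and measT: "{v. T v = P} \<in> sets borel \<and> emeasure \<mu> {v. T v = P} < \<infinity>"
    if "P \<in> Pow D - {{}}" for P
    unfolding S_def T_def
    by (rule meas[where E=A0 and G="fst ` C", OF AB0(1) cpt(1) that],
        rule meas[where E=B0 and G="snd ` C", OF AB0(2) cpt(2) that])
  show ?thesis
  proof (rule fubini_on_sum_boxes[where J=J and c=val and A="\<lambda>j. {u. S u = fst j}" and B="\<lambda>j. {v. T v = snd j}"])
    fix u v
    have "(\<Sum>j\<in>J. val j * (indicator {u. S u = fst j} u * indicator {v. T v = snd j} v)) =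
        (\<Sum>j\<in>J. if j = (S u, T v) then val j else 0)"
      by (intro sum.cong refl) (auto simp: indicator_def)
    also have "\<dots> = (if (S u, T v) \<in> J then val (S u, T v) else 0)"
      using fin by (simp add: sum.delta')
    also have "\<dots> = val (S u, T v)"
      by (auto simp: J_def S_def T_def val_def)
    finally show "f (u, v) = (\<Sum>j\<in>J. val j * (indicator {u. S u = fst j} u * indicator {v. T v = snd j} v))"
      by (simp add: f_val)
  next
    fix j assume "j \<in> J"
    then have j: "fst j \<in> Pow D - {{}}" "snd j \<in> Pow D - {{}}" by (auto simp: J_def)
    show "{u. S u = fst j} \<in> sets borel \<and> emeasure \<mu> {u. S u = fst j} < \<infinity>"
      by (rule measS[OF j(1)])
    show "{v. T v = snd j} \<in> sets borel \<and> emeasure \<mu> {v. T v = snd j} < \<infinity>"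
      by (rule measT[OF j(2)])
  qed
qed

lemma continuous_shear:
  fixes p :: "'k \<Rightarrow> 'k"
  assumes "continuous_on UNIV p"
  shows "continuous_on UNIV (\<lambda>z::'k \<times> 'k. (fst z, snd z - p (fst z)))"
    "continuous_on UNIV (\<lambda>z::'k \<times> 'k. (fst z, snd z + p (fst z)))"
proof -
  have "continuous_on UNIV (\<lambda>z::'k \<times> 'k. p (fst z))"
    by (rule continuous_on_compose2[OF assms]) (auto intro: continuous_intros)
  then show "continuous_on UNIV (\<lambda>z::'k \<times> 'k. (fst z, snd z - p (fst z)))"
    "continuous_on UNIV (\<lambda>z::'k \<times> 'k. (fst z, snd z + p (fst z)))"
    by (intro continuous_on_Pair field_continuous_on_diff field_continuous_on_add continuous_on_fst
        continuous_on_snd continuous_on_id; assumption)+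
qed

lemma fubini_on_shear_locally_constant:
  assumes lc: "\<And>z :: 'k \<times> 'k. \<exists>U. open U \<and> z \<in> U \<and> (\<forall>w\<in>U. f w = f z)"
    and C: "compact C" "\<And>z. f z \<noteq> 0 \<Longrightarrow> z \<in> C"
    and p: "continuous_on UNIV p"
  shows "fubini_on (\<lambda>u v. f (u, v - p u))"
proof -
  define s where "s = (\<lambda>z::'k \<times> 'k. (fst z, snd z - p (fst z)))"
  define s' where "s' = (\<lambda>z::'k \<times> 'k. (fst z, snd z + p (fst z)))"
  have cont: "continuous_on UNIV s" "continuous_on UNIV s'"
    using continuous_shear[OF p] by (auto simp: s_def s'_def)
  have "fubini_on (\<lambda>u v. (f \<circ> s) (u, v))"
  proof (rule fubini_on_locally_constant)
    fix z
    obtain U where U: "open U" "s z \<in> U" "\<forall>w\<in>U. f w = f (s z)" using lc by blast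
    have "open (s -` U)" by (rule open_vimage[OF U(1) cont(1)])
    moreover have "z \<in> s -` U" "\<forall>w\<in>s -` U. (f \<circ> s) w = (f \<circ> s) z"
      using U(2,3) unfolding comp_def by blast+
    ultimately show "\<exists>U. open U \<and> z \<in> U \<and> (\<forall>w\<in>U. (f \<circ> s) w = (f \<circ> s) z)" by blast
  next
    show "compact (s' ` C)"
      by (rule compact_continuous_image[OF continuous_on_subset[OF cont(2) subset_UNIV] C(1)])
    fix z assume "(f \<circ> s) z \<noteq> 0"
    then have "s z \<in> C" using C(2) by simp
    moreover have "s' (s z) = z" by (simp add: s_def s'_def)
    ultimately show "z \<in> s' ` C" by (metis imageI)
  qed
  then show ?thesis by (simp add: s_def)
qed

section \<open>Rapidly decreasing functions on archimedean fields\<close>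

text \<open>Doubling: a compact ball of radius 2 is covered by finitely many unit balls, so the measure of
  balls grows at most polynomially in the radius.\<close>
lemma polynomial_decay_integrable:
  fixes \<phi> :: "'k \<Rightarrow> 'e::euclidean_space"
  assumes \<phi>: "bij \<phi>" "continuous_on UNIV \<phi>" "continuous_on UNIV (inv \<phi>)"
    and add: "\<And>x y. \<phi> (x + y) = \<phi> x + \<phi> y"
  shows "\<exists>N::nat. (\<integral>\<^sup>+x. ennreal (1 / (1 + norm (\<phi> x)) ^ N) \<partial>\<mu>) < \<infinity>"
proof -
  define ball where "ball k = \<phi> -` cball 0 (2 ^ k)" for k :: nat
  have cpt: "compact (ball k)" for k
  proof -
    have "ball k = inv \<phi> ` cball 0 (2 ^ k)"
      by (simp add: ball_def bij_vimage_eq_inv_image[OF \<phi>(1)])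
    then show ?thesis
      using continuous_on_subset[OF \<phi>(3)] by (simp add: compact_continuous_image)
  qed
  have meas: "ball k \<in> sets borel" for k
    using compact_imp_closed[OF cpt] by auto
  obtain P :: "'e set" where P: "finite P" "cball 0 2 \<subseteq> (\<Union>p\<in>P. Elementary_Metric_Spaces.ball p 1)"
    using compactE_image[of "cball (0::'e) 2" "cball 0 2" "\<lambda>p. Elementary_Metric_Spaces.ball p 1"]
    by (metis (no_types, lifting) UN_I centre_in_ball compact_cball open_ball subsetI zero_less_one)
  \<comment> \<open>The number \<open>m\<close> is both the growth factor of the measure under
    doubling and the decay exponent finally chosen. The resulting geometric series has ratio
    \<open>m / 2 ^ m\<close>, which is below 1.\<close>
  define m where "m = card P"
  \<comment> \<open>Since \<open>\<phi>\<close> is only assumed additive, the rescaling takes place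
    in the Euclidean space, and the centres are carried back to \<open>K\<close> by
    \<open>inv \<phi>\<close>.\<close>
  have cover: "ball (Suc k) \<subseteq> (\<Union>p\<in>P. (+) (inv \<phi> (2 ^ k *\<^sub>R p)) ` ball k)" for k
  proof
    fix x assume "x \<in> ball (Suc k)"
    then have "norm (\<phi> x) \<le> 2 * 2 ^ k" by (simp add: ball_def)
    then have "(1 / 2 ^ k) *\<^sub>R \<phi> x \<in> cball 0 2" by (simp add: field_simps)
    then obtain p where p: "p \<in> P" "norm (p - (1 / 2 ^ k) *\<^sub>R \<phi> x) < 1"
      using P by (force simp: dist_norm)
    define y where "y = x - inv \<phi> (2 ^ k *\<^sub>R p)"
    have xy: "x = inv \<phi> (2 ^ k *\<^sub>R p) + y" by (simp add: y_def)
    have "\<phi> x = 2 ^ k *\<^sub>R p + \<phi> y"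
      by (subst xy) (simp add: add surj_f_inv_f[OF bij_is_surj[OF \<phi>(1)]])
    then have "\<phi> y = (- (2 ^ k)) *\<^sub>R (p - (1 / 2 ^ k) *\<^sub>R \<phi> x)"
      by (simp add: algebra_simps)
    then have "norm (\<phi> y) = 2 ^ k * norm (p - (1 / 2 ^ k) *\<^sub>R \<phi> x)"
      by (simp only: norm_scaleR) simp
    then have "norm (\<phi> y) \<le> 2 ^ k" using p by simp
    then have "y \<in> ball k" by (simp add: ball_def)
    then show "x \<in> (\<Union>p\<in>P. (+) (inv \<phi> (2 ^ k *\<^sub>R p)) ` ball k)"
      using p(1) xy by blast
  qed
  have step: "emeasure \<mu> (ball (Suc k)) \<le> of_nat m * emeasure \<mu> (ball k)" for k
  proof -
    have sets: "(+) a ` ball k \<in> sets borel" for a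
      using compact_imp_closed[OF compact_translate[OF cpt]] by auto
    have "emeasure \<mu> (ball (Suc k)) \<le> emeasure \<mu> (\<Union>p\<in>P. (+) (inv \<phi> (2 ^ k *\<^sub>R p)) ` ball k)"
      using cover sets P by (intro emeasure_mono) auto
    also have "\<dots> \<le> (\<Sum>p\<in>P. emeasure \<mu> ((+) (inv \<phi> (2 ^ k *\<^sub>R p)) ` ball k))"
      using sets P by (intro emeasure_subadditive_finite) auto
    also have "\<dots> = of_nat m * emeasure \<mu> (ball k)"
      by (simp add: emeasure_translate meas m_def)
    finally show ?thesis .
  qed
  define c where "c = measure \<mu> (ball 0)"
  have growth: "emeasure \<mu> (ball k) \<le> ennreal (real m ^ k * c)" for k
  proof (induction k)
    case 0
    then show ?case
      using emeasure_compact_finite[OF cpt[of 0]] by (simp add: c_def emeasure_eq_ennreal_measure)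
  next
    case (Suc k)
    have "emeasure \<mu> (ball (Suc k)) \<le> ennreal (real m) * ennreal (real m ^ k * c)"
      using order_trans[OF step mult_left_mono[OF Suc]] by (simp add: ennreal_of_nat_eq_real_of_nat)
    also have "\<dots> = ennreal (real m ^ Suc k * c)"
      by (simp add: ennreal_mult[symmetric] c_def mult.assoc)
    finally show ?case .
  qed
  \<comment> \<open>If \<open>k\<close> is least with \<open>x\<close> in \<open>ball k\<close>,
    then \<open>1 + norm (\<phi> x)\<close> is at least \<open>2 ^ k / 2\<close>, the summand 1
    taking care of \<open>k = 0\<close>. So \<open>w k\<close> bounds the integrand at
    \<open>x\<close>.\<close>
  define w :: "nat \<Rightarrow> real" where "w k = (2 / 2 ^ k) ^ m" for k
  have w0: "w k \<ge> 0" for k by (simp add: w_def)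
  have dom: "ennreal (1 / (1 + norm (\<phi> x)) ^ m) \<le> (\<Sum>k. ennreal (w k) * indicator (ball k) x)" for x
  proof -
    have ex: "\<exists>k::nat. norm (\<phi> x) \<le> 2 ^ k"
      by (metis less_imp_le one_less_numeral_iff real_arch_pow semiring_norm(76))
    define k where "k = (LEAST k::nat. norm (\<phi> x) \<le> 2 ^ k)"
    have k: "norm (\<phi> x) \<le> 2 ^ k" unfolding k_def by (rule LeastI_ex[OF ex])
    have "2 ^ k / 2 \<le> 1 + norm (\<phi> x)"
    proof (cases k)
      case (Suc j)
      then have "\<not> norm (\<phi> x) \<le> 2 ^ j" unfolding k_def using not_less_Least by (metis lessI)
      then show ?thesis using Suc by simp
    qed (simp add: add_increasing2)
    then have "(2 ^ k / 2) ^ m \<le> (1 + norm (\<phi> x)) ^ m" by (intro power_mono) auto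
    then have "1 / (1 + norm (\<phi> x)) ^ m \<le> 1 / (2 ^ k / 2) ^ m"
      by (intro divide_left_mono mult_pos_pos zero_less_power) (auto simp: add_pos_nonneg)
    also have "\<dots> = w k" by (simp add: w_def power_divide)
    finally have "ennreal (1 / (1 + norm (\<phi> x)) ^ m) \<le> ennreal (w k) * indicator (ball k) x"
      using k by (simp add: ball_def ennreal_leI)
    also have "\<dots> = (\<Sum>k\<in>{k}. ennreal (w k) * indicator (ball k) x)"
      by (simp only: sum.insert finite.emptyI empty_iff not_False_eq_True sum.empty add_0_right)
    also have "\<dots> \<le> (\<Sum>k. ennreal (w k) * indicator (ball k) x)"
      by (intro sum_le_suminf) auto
    finally show ?thesis .
  qed
  have "(\<integral>\<^sup>+x. ennreal (1 / (1 + norm (\<phi> x)) ^ m) \<partial>\<mu>) \<le>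
      (\<integral>\<^sup>+x. (\<Sum>k. ennreal (w k) * indicator (ball k) x) \<partial>\<mu>)"
    by (intro nn_integral_mono dom)
  also have "\<dots> = (\<Sum>k. \<integral>\<^sup>+x. ennreal (w k) * indicator (ball k) x \<partial>\<mu>)"
    using meas by (intro nn_integral_suminf) auto
  also have "\<dots> = (\<Sum>k. ennreal (w k) * emeasure \<mu> (ball k))"
    using meas by (simp add: nn_integral_cmult_indicator)
  also have "\<dots> \<le> (\<Sum>k. ennreal (2 ^ m * c * (real m / 2 ^ m) ^ k))"
  proof (intro suminf_le allI)
    fix k
    have "ennreal (w k) * emeasure \<mu> (ball k) \<le> ennreal (w k) * ennreal (real m ^ k * c)"
      by (intro mult_left_mono growth) auto
    also have "\<dots> = ennreal (w k * (real m ^ k * c))"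
      using w0 by (simp add: ennreal_mult c_def)
    also have "w k * (real m ^ k * c) = 2 ^ m * c * (real m / 2 ^ m) ^ k"
      by (simp add: w_def power_divide power_mult[symmetric] mult.commute)
    finally show "ennreal (w k) * emeasure \<mu> (ball k) \<le> ennreal (2 ^ m * c * (real m / 2 ^ m) ^ k)" .
  qed auto
  also have "\<dots> < \<infinity>"
  proof -
    have "real m < 2 ^ m" by (rule of_nat_less_two_power)
    then have "summable (\<lambda>k. 2 ^ m * c * (real m / 2 ^ m) ^ k)"
      by (intro summable_mult summable_geometric) simp
    then show ?thesis
      by (simp add: less_top[symmetric] ennreal_suminf_neq_top c_def)
  qed
  finally show ?thesis by blast
qed

text \<open>Rapid decay bounds \<open>f (u, v)\<close> by a multiple of \<open>d u * d v\<close>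
  with \<open>d\<close> integrable. For fixed \<open>u\<close> the shear merely translates the
  second factor, which keeps its integral; so the sheared function is absolutely integrable on the
  product and the classical Fubini theorem applies.\<close>

lemma fubini_on_shear_schwartz:
  fixes \<phi> :: "'k \<Rightarrow> 'e::euclidean_space"
  assumes \<phi>: "bij \<phi>" "continuous_on UNIV \<phi>" "continuous_on UNIV (inv \<phi>)"
    and add: "\<And>x y. \<phi> (x + y) = \<phi> x + \<phi> y"
    and SB: "schwartz (\<lambda>p :: 'e \<times> 'e. f (inv \<phi> (fst p), inv \<phi> (snd p)))"
    and p: "continuous_on UNIV p"
  shows "fubini_on (\<lambda>u v. f (u, v - p u))"
proof -
  define g where "g = (\<lambda>p :: 'e \<times> 'e. f (inv \<phi> (fst p), inv \<phi> (snd p)))"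
  have inv: "inv \<phi> (\<phi> x) = x" for x using \<phi>(1) by (simp add: bij_is_inj)
  have fg: "f (u, v) = g (\<phi> u, \<phi> v)" for u v by (simp add: g_def inv)
  have "\<And>x. ddiff [] g differentiable (at x)" using SB unfolding schwartz_def g_def by blast
  then have "continuous_on UNIV g"
    by (simp add: continuous_at_imp_continuous_on differentiable_imp_continuous_within)
  then have g_meas [measurable]: "g \<in> borel_measurable borel"
    by (rule borel_measurable_continuous_onI)
  obtain N :: nat where N: "(\<integral>\<^sup>+x. ennreal (1 / (1 + norm (\<phi> x)) ^ N) \<partial>\<mu>) < \<infinity>"
    using polynomial_decay_integrable[OF \<phi> add] by blast
  \<comment> \<open>The norm of a pair dominates the norms of both coordinates, so decay of order
    \<open>N + N\<close> leaves order \<open>N\<close> for each.\<close>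
  have "\<exists>C. \<forall>x. (1 + norm x) ^ (N + N) * norm (ddiff [] g x) \<le> C"
    using SB unfolding schwartz_def g_def by blast
  then obtain C where C: "\<And>x. (1 + norm x) ^ (N + N) * norm (g x) \<le> C" by auto
  have C0: "C \<ge> 0" using C[of 0] by (simp add: order_trans[OF norm_ge_zero])
  define d where "d u = 1 / (1 + norm (\<phi> u)) ^ N" for u
  have d: "d u \<ge> 0" "d u \<le> 1" for u
    by (auto simp: d_def divide_le_eq_1 add_pos_nonneg one_le_power)
  have bound: "norm (f (u, v)) \<le> C * (d u * d v)" for u v
  proof -
    define z where "z = (\<phi> u, \<phi> v)"
    have "norm (\<phi> u) \<le> norm z" "norm (\<phi> v) \<le> norm z"
      by (simp_all add: z_def norm_fst_le norm_snd_le)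
    then have "(1 + norm (\<phi> u)) ^ N * (1 + norm (\<phi> v)) ^ N \<le> (1 + norm z) ^ N * (1 + norm z) ^ N"
      by (intro mult_mono power_mono) auto
    then have "(1 + norm (\<phi> u)) ^ N * (1 + norm (\<phi> v)) ^ N * norm (g z) \<le> C"
      using C[of z] by (metis mult_right_mono norm_ge_zero order_trans power_add)
    moreover have "0 < (1 + norm (\<phi> u)) ^ N" "0 < (1 + norm (\<phi> v)) ^ N"
      by (auto simp: add_pos_nonneg)
    ultimately have "norm (g z) \<le> C / ((1 + norm (\<phi> u)) ^ N * (1 + norm (\<phi> v)) ^ N)"
      by (simp add: pos_le_divide_eq mult.commute)
    then show ?thesis by (simp add: fg z_def d_def)
  qed
  have \<phi>_borel: "\<phi> \<in> borel_measurable borel" "(\<lambda>u. \<phi> (p u)) \<in> borel_measurable borel"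
    using \<phi>(2) continuous_on_compose2[OF \<phi>(2) p] by (auto intro: borel_measurable_continuous_onI)
  then have \<phi>_meas [measurable]: "\<phi> \<in> borel_measurable \<mu>" "(\<lambda>u. \<phi> (p u)) \<in> borel_measurable \<mu>"
    by (simp_all cong: measurable_cong_sets)
  have d_meas [measurable]: "d \<in> borel_measurable \<mu>" unfolding d_def by measurable
  have d_fin: "(\<integral>\<^sup>+x. ennreal (d x) \<partial>\<mu>) < \<infinity>" using N by (simp add: d_def)
  have \<phi>_diff: "\<phi> (v - p u) = \<phi> v - \<phi> (p u)" for u v
    using add[of "v - p u" "p u"] by simp
  define H where "H = (\<lambda>u v. f (u, v - p u))"
  \<comment> \<open>Expressing \<open>H\<close> through the continuous function \<open>g\<close> on
    Euclidean space gives measurability for the product sigma-algebra on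
    \<open>K \<times> K\<close>.\<close>
  have Hg: "H u v = g (\<phi> u, \<phi> v - \<phi> (p u))" for u v by (simp add: H_def fg \<phi>_diff)
  have H_bound: "norm (H u v) \<le> C * (d u * d (v - p u))" for u v
    using bound by (simp add: H_def)
  interpret sigma_finite_measure \<mu>
  proof
    define A where "A = range (\<lambda>n::nat. \<phi> -` cball 0 (real n))"
    have cpt: "compact (\<phi> -` cball 0 (real n))" for n
      using continuous_on_subset[OF \<phi>(3)]
      by (simp add: bij_vimage_eq_inv_image[OF \<phi>(1)] compact_continuous_image)
    have "A \<subseteq> sets \<mu>"
      using borel_closed[OF compact_imp_closed[OF cpt]] by (auto simp: A_def)
    moreover have "emeasure \<mu> a \<noteq> \<infinity>" if "a \<in> A" for a
      using that emeasure_compact_finite[OF cpt] by (auto simp: A_def less_top[symmetric])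
    moreover have "\<Union>A = space \<mu>"
      by (auto simp: A_def intro: real_arch_simple)
    ultimately show "\<exists>A. countable A \<and> A \<subseteq> sets \<mu> \<and> \<Union>A = space \<mu> \<and> (\<forall>a\<in>A. emeasure \<mu> a \<noteq> \<infinity>)"
      by (intro exI[of _ A]) (auto simp: A_def)
  qed
  interpret P: pair_sigma_finite \<mu> \<mu> ..
  have H_meas [measurable]: "(\<lambda>z. H (fst z) (snd z)) \<in> borel_measurable (\<mu> \<Otimes>\<^sub>M \<mu>)"
    unfolding Hg by measurable
  \<comment> \<open>Fubini's theorem controls only almost every section, so each section is bounded
    directly: one of the two decay factors is estimated by 1 and the other is integrated.\<close>
  have sec1: "integrable \<mu> (H u)" for u
  proof (rule integrableI_bounded)
    show "H u \<in> borel_measurable \<mu>" unfolding Hg[abs_def] by measurable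
    have "(\<integral>\<^sup>+v. norm (H u v) \<partial>\<mu>) \<le> (\<integral>\<^sup>+v. ennreal C * ennreal (d (v + (- p u))) \<partial>\<mu>)"
    proof (intro nn_integral_mono)
      fix v
      have "C * (d u * d (v - p u)) \<le> C * (1 * d (v - p u))"
        using C0 d by (intro mult_left_mono mult_right_mono) auto
      then show "ennreal (norm (H u v)) \<le> ennreal C * ennreal (d (v + (- p u)))"
        using H_bound[of u v] C0 d by (simp add: ennreal_mult[symmetric] ennreal_leI)
    qed
    also have "\<dots> = ennreal C * (\<integral>\<^sup>+v. ennreal (d v) \<partial>\<mu>)"
      using nn_integral_translate[of "\<lambda>v. ennreal C * ennreal (d v)" "- p u"]
      by (simp add: nn_integral_cmult)
    finally show "(\<integral>\<^sup>+v. norm (H u v) \<partial>\<mu>) < \<infinity>"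
      using d_fin by (auto simp: ennreal_mult_less_top intro: le_less_trans)
  qed
  have sec2: "integrable \<mu> (\<lambda>u. H u v)" for v
  proof (rule integrableI_bounded)
    show "(\<lambda>u. H u v) \<in> borel_measurable \<mu>" unfolding Hg by measurable
    have "(\<integral>\<^sup>+u. norm (H u v) \<partial>\<mu>) \<le> (\<integral>\<^sup>+u. ennreal C * ennreal (d u) \<partial>\<mu>)"
    proof (intro nn_integral_mono)
      fix u
      have "C * (d u * d (v - p u)) \<le> C * (d u * 1)"
        using C0 d by (intro mult_left_mono) auto
      then show "ennreal (norm (H u v)) \<le> ennreal C * ennreal (d u)"
        using H_bound[of u v] C0 d by (simp add: ennreal_mult[symmetric] ennreal_leI)
    qed
    also have "\<dots> = ennreal C * (\<integral>\<^sup>+v. ennreal (d v) \<partial>\<mu>)"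
      by (simp add: nn_integral_cmult)
    finally show "(\<integral>\<^sup>+u. norm (H u v) \<partial>\<mu>) < \<infinity>"
      using d_fin by (auto simp: ennreal_mult_less_top intro: le_less_trans)
  qed
  have joint: "integrable (\<mu> \<Otimes>\<^sub>M \<mu>) (\<lambda>z. H (fst z) (snd z))"
  proof (rule integrableI_bounded)
    have "(\<integral>\<^sup>+z. norm (H (fst z) (snd z)) \<partial>(\<mu> \<Otimes>\<^sub>M \<mu>)) = (\<integral>\<^sup>+u. \<integral>\<^sup>+v. norm (H u v) \<partial>\<mu> \<partial>\<mu>)"
      by (subst nn_integral_fst[symmetric]) auto
    also have "\<dots> \<le> (\<integral>\<^sup>+u. ennreal C * ennreal (d u) * (\<integral>\<^sup>+v. ennreal (d v) \<partial>\<mu>) \<partial>\<mu>)"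
    proof (intro nn_integral_mono)
      fix u
      have "(\<integral>\<^sup>+v. norm (H u v) \<partial>\<mu>) \<le> (\<integral>\<^sup>+v. ennreal C * ennreal (d u) * ennreal (d (v + (- p u))) \<partial>\<mu>)"
        using H_bound[of u] C0 d
        by (intro nn_integral_mono) (simp add: ennreal_mult[symmetric] ennreal_leI mult.assoc)
      also have "\<dots> = ennreal C * ennreal (d u) * (\<integral>\<^sup>+v. ennreal (d v) \<partial>\<mu>)"
        using nn_integral_translate[of "\<lambda>v. ennreal C * ennreal (d u) * ennreal (d v)" "- p u"]
        by (simp add: nn_integral_cmult)
      finally show "(\<integral>\<^sup>+v. norm (H u v) \<partial>\<mu>) \<le> ennreal C * ennreal (d u) * (\<integral>\<^sup>+v. ennreal (d v) \<partial>\<mu>)" .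
    qed
    also have "\<dots> = ennreal C * (\<integral>\<^sup>+u. ennreal (d u) \<partial>\<mu>) * (\<integral>\<^sup>+v. ennreal (d v) \<partial>\<mu>)"
      by (simp add: nn_integral_cmult nn_integral_multc)
    also have "\<dots> < \<infinity>" using d_fin by (simp add: ennreal_mult_less_top)
    finally show "(\<integral>\<^sup>+z. norm (H (fst z) (snd z)) \<partial>(\<mu> \<Otimes>\<^sub>M \<mu>)) < \<infinity>" .
  qed measurable
  then have joint': "integrable (\<mu> \<Otimes>\<^sub>M \<mu>) (case_prod H)" by (simp add: case_prod_unfold)
  have "fubini_on H"
    unfolding fubini_on_def
    using sec1 sec2 P.integrable_fst[OF joint'] P.integrable_snd[OF joint'] P.Fubini_integral[OF joint']
    by simp
  then show ?thesis by (simp add: H_def)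
qed

lemma fubini_on_shear:
  assumes SB: "schwartz_bruhat f" and p: "continuous_on UNIV p"
  shows "fubini_on (\<lambda>u v. f (u, v - p u))"
proof (cases "connected (UNIV :: 'k set)")
  case True
  then consider \<phi> where "top_field_iso (\<phi> :: 'k \<Rightarrow> real)"
      "schwartz (\<lambda>p :: real \<times> real. f (inv \<phi> (fst p), inv \<phi> (snd p)))"
    | \<phi> where "top_field_iso (\<phi> :: 'k \<Rightarrow> complex)"
      "schwartz (\<lambda>p :: complex \<times> complex. f (inv \<phi> (fst p), inv \<phi> (snd p)))"
    using SB unfolding schwartz_bruhat_def by auto
  then show ?thesis
  proof cases
    case 1
    from 1(1) show ?thesis
      unfolding top_field_iso_def by (intro fubini_on_shear_schwartz[OF _ _ _ _ 1(2) p]) blast+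
  next
    case 2
    from 2(1) show ?thesis
      unfolding top_field_iso_def by (intro fubini_on_shear_schwartz[OF _ _ _ _ 2(2) p]) blast+
  qed
next
  case False
  with SB obtain C where "compact C" "\<And>z. f z \<noteq> 0 \<Longrightarrow> z \<in> C"
    and "\<And>z. \<exists>U. open U \<and> z \<in> U \<and> (\<forall>w\<in>U. f w = f z)"
    unfolding schwartz_bruhat_def by auto
  then show ?thesis using p by (intro fubini_on_shear_locally_constant)
qed

end

section \<open>Well-definedness of the integral on F\<close>

lemma cconst_0 [simp]: "cconst 0 = 0"
  by (simp add: cconst_def Zero_fract_def)

lemma common_denominator:
  fixes rs :: "'a::idom fract list"
  shows "\<exists>d. d \<noteq> 0 \<and> (\<forall>r\<in>set rs. \<exists>p. r = Fract p d)"
proof (induction rs)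
  case (Cons r rs)
  then obtain d where d: "d \<noteq> 0" "\<And>r. r \<in> set rs \<Longrightarrow> \<exists>p. r = Fract p d" by blast
  obtain p e where r: "r = Fract p e" "e \<noteq> 0" by (cases r) auto
  have "\<exists>q. s = Fract q (d * e)" if "s \<in> set (r # rs)" for s
  proof (cases "s = r")
    case True
    then have "s = Fract (d * p) (d * e)" using r d by (simp add: eq_fract)
    then show ?thesis by blast
  next
    case False
    then have "s \<in> set rs" using that by simp
    then obtain q where "s = Fract q d" using d(2) by blast
    then have "s = Fract (e * q) (d * e)" using r d by (simp add: eq_fract)
    then show ?thesis by blast
  qed
  then show ?case using d r by (intro exI[of _ "d * e"]) auto
qed (auto intro: exI[of _ 1])

lemma Fract_mult_cconst: "d \<noteq> 0 \<Longrightarrow> Fract p d * cconst c = Fract (smult c p) d"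
  by (simp add: cconst_def mult.commute)

lemma sum_list_Fract:
  assumes "d \<noteq> 0"
  shows "(\<Sum>x\<leftarrow>xs. Fract (g x) d) = Fract (\<Sum>x\<leftarrow>xs. g x) d"
  by (induction xs) (use assms in \<open>simp_all add: eq_fract Zero_fract_def algebra_simps\<close>)

context haar_local_field
begin

text \<open>Clearing denominators and comparing coefficients reduces this to complex-valued functions.\<close>
lemma integral_zero_if_const:
  fixes xs :: "'a list" and r :: "'a \<Rightarrow> CX" and f :: "'a \<Rightarrow> 'k \<Rightarrow> complex"
  assumes int: "\<And>x. x \<in> set xs \<Longrightarrow> integrable \<mu> (f x)"
    and const: "\<And>u. (\<Sum>x\<leftarrow>xs. r x * cconst (f x u)) = C"
  shows "C = 0" "(\<Sum>x\<leftarrow>xs. r x * cconst (LINT u|\<mu>. f x u)) = 0"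
proof -
  obtain d where d: "d \<noteq> 0" "\<And>x. x \<in> set xs \<Longrightarrow> \<exists>p. r x = Fract p d"
    using common_denominator[of "map r xs"] by auto
  then obtain p where p: "\<And>x. x \<in> set xs \<Longrightarrow> r x = Fract (p x) d" by metis
  have sums: "(\<Sum>x\<leftarrow>xs. r x * cconst (g x)) = Fract (\<Sum>x\<leftarrow>xs. smult (g x) (p x)) d" for g
  proof -
    have "(\<Sum>x\<leftarrow>xs. r x * cconst (g x)) = (\<Sum>x\<leftarrow>xs. Fract (smult (g x) (p x)) d)"
      by (intro arg_cong[where f=sum_list] map_cong refl) (simp add: p Fract_mult_cconst d)
    then show ?thesis by (simp add: sum_list_Fract d)
  qed
  define S where "S = (\<lambda>u. \<Sum>x\<leftarrow>xs. smult (f x u) (p x))"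
  have SC: "Fract (S u) d = C" for u
    using const[of u] by (simp add: sums S_def)
  then have Seq: "S u = S 0" for u
    using d(1) by (metis eq_fract(1) mult_right_cancel)
  have coeff_sum: "coeff (\<Sum>x\<leftarrow>ys. smult (g x) (p x)) k = (\<Sum>x\<leftarrow>ys. g x * coeff (p x) k)" for g ys k
    by (induction ys) auto
  \<comment> \<open>Each coefficient of \<open>S u\<close> is a complex combination of the functions
    \<open>f x\<close>, hence integrable in \<open>u\<close>. It is also constant, so it vanishes;
    integrating it then gives the second claim coefficient by coefficient.\<close>
  have int': "integrable \<mu> (\<lambda>u. \<Sum>x\<leftarrow>ys. f x u * coeff (p x) k) \<and>
     (LINT u|\<mu>. (\<Sum>x\<leftarrow>ys. f x u * coeff (p x) k)) = (\<Sum>x\<leftarrow>ys. (LINT u|\<mu>. f x u) * coeff (p x) k)"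
    if "set ys \<subseteq> set xs" for ys k
    using that by (induction ys) (auto simp: int)
  have coeffS: "(\<lambda>u. \<Sum>x\<leftarrow>xs. f x u * coeff (p x) k) = (\<lambda>u. coeff (S 0) k)" for k
  proof
    fix u
    have "(\<Sum>x\<leftarrow>xs. f x u * coeff (p x) k) = coeff (S u) k"
      by (simp only: S_def coeff_sum)
    also have "S u = S 0" by (rule Seq)
    finally show "(\<Sum>x\<leftarrow>xs. f x u * coeff (p x) k) = coeff (S 0) k" .
  qed
  have S0: "S 0 = 0"
  proof (rule poly_eqI)
    fix k
    show "coeff (S 0) k = coeff 0 k"
      using int'[of xs k] unfolding coeffS by (metis coeff_0 integrable_const_iff_zero order_refl)
  qed
  have Fract0: "Fract 0 d = 0" using d(1) by (simp add: eq_fract Zero_fract_def)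
  show "C = 0" using SC[of 0] Fract0 S0 by simp
  have "(\<Sum>x\<leftarrow>xs. smult (LINT u|\<mu>. f x u) (p x)) = 0"
  proof (rule poly_eqI)
    fix k
    show "coeff (\<Sum>x\<leftarrow>xs. smult (LINT u|\<mu>. f x u) (p x)) k = coeff 0 k"
      unfolding coeff_sum using int'[of xs k] unfolding coeffS by (simp add: S0)
  qed
  then show "(\<Sum>x\<leftarrow>xs. r x * cconst (LINT u|\<mu>. f x u)) = 0"
    by (simp add: sums Fract0)
qed

end

section \<open>Valuation, residues and the behaviour of lifts on cosets\<close>

locale residue_dvf =
  fixes \<nu> :: "'f::field \<Rightarrow> int" and t :: 'f and res :: "'f \<Rightarrow> 'k::field"
  assumes cdvf: "cdvf \<nu> t res"
begin

abbreviation "\<O> \<equiv> vring \<nu>"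

lemma val_mult: "x \<noteq> 0 \<Longrightarrow> y \<noteq> 0 \<Longrightarrow> \<nu> (x * y) = \<nu> x + \<nu> y"
  using cdvf unfolding cdvf_def by simp

lemma val_add: "x \<noteq> 0 \<Longrightarrow> y \<noteq> 0 \<Longrightarrow> x + y \<noteq> 0 \<Longrightarrow> min (\<nu> x) (\<nu> y) \<le> \<nu> (x + y)"
  using cdvf unfolding cdvf_def by simp

lemma t_nonzero [simp]: "t \<noteq> 0" and val_t: "\<nu> t = 1"
  using cdvf unfolding cdvf_def by simp_all

lemma val_1: "\<nu> 1 = 0"
  using val_mult[of 1 1] by simp

lemma val_minus_1: "\<nu> (- 1) = 0"
  using val_mult[of "-1" "-1"] by (simp add: val_1)

lemma val_power: "\<nu> (t ^ n) = int n"
  by (induction n) (simp_all add: val_1 val_t val_mult)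

lemma val_inverse: "x \<noteq> 0 \<Longrightarrow> \<nu> (inverse x) = - \<nu> x"
  using val_mult[of x "inverse x"] by (simp add: val_1)

lemma val_powi: "\<nu> (t powi n) = n"
  by (simp add: power_int_def val_power val_inverse power_inverse)

lemma vring_0 [simp]: "0 \<in> \<O>"
  by (simp add: vring_def)

lemma vring_mult: "x \<in> \<O> \<Longrightarrow> y \<in> \<O> \<Longrightarrow> x * y \<in> \<O>"
  by (cases "x = 0 \<or> y = 0") (auto simp: vring_def val_mult)

lemma vring_add:
  assumes "x \<in> \<O>" "y \<in> \<O>" shows "x + y \<in> \<O>"
proof (cases "x = 0 \<or> y = 0 \<or> x + y = 0")
  case False
  then show ?thesis using val_add[of x y] assms by (auto simp: vring_def)
qed (use assms in \<open>auto simp: vring_def\<close>)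

lemma vring_uminus: "x \<in> \<O> \<Longrightarrow> - x \<in> \<O>"
  using vring_mult[of "- 1" x] by (simp add: vring_def val_minus_1)

lemma vring_diff: "x \<in> \<O> \<Longrightarrow> y \<in> \<O> \<Longrightarrow> x - y \<in> \<O>"
  using vring_add[of x "- y"] vring_uminus by simp

lemma vring_powi: "t powi n \<in> \<O> \<longleftrightarrow> 0 \<le> n"
  by (simp add: vring_def val_powi)

lemma res_add: "x \<in> \<O> \<Longrightarrow> y \<in> \<O> \<Longrightarrow> res (x + y) = res x + res y"
  and res_mult: "x \<in> \<O> \<Longrightarrow> y \<in> \<O> \<Longrightarrow> res (x * y) = res x * res y"
  and res_eq_0_iff: "x \<in> \<O> \<Longrightarrow> res x = 0 \<longleftrightarrow> x = 0 \<or> 1 \<le> \<nu> x"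
  using cdvf unfolding cdvf_def by simp_all

lemma res_surj: "\<exists>x\<in>\<O>. res x = u"
proof -
  have "res ` \<O> = UNIV" using cdvf unfolding cdvf_def by (elim conjE)
  then show ?thesis by (metis UNIV_I imageE)
qed

lemma res_diff: "x \<in> \<O> \<Longrightarrow> y \<in> \<O> \<Longrightarrow> res (x - y) = res x - res y"
  using res_add[of "x - y" y] vring_diff by (simp add: algebra_simps)

lemma res_powi_eq_0: "0 < n \<Longrightarrow> res (t powi n) = 0"
  using res_eq_0_iff[of "t powi n"] by (simp add: vring_powi val_powi)

text \<open>When \<open>b\<close> lies in the coset of \<open>a\<close> at level \<open>n\<close>,
  recentring a lift at \<open>a\<close> only translates \<open>f\<close> by a residue.\<close>

lemma lift_at_coset:
  assumes "(a - b) / t powi n \<in> \<O>" "u \<in> \<O>"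
  shows "lift \<nu> t res f b n (a + t powi n * u) = f (res u + res ((a - b) / t powi n))"
proof -
  have "(a + t powi n * u - b) / t powi n = u + (a - b) / t powi n"
    by (simp add: field_simps)
  then show ?thesis using assms by (simp add: lift_def lift0_def vring_add res_add)
qed

text \<open>Two cosets of the same level are equal or disjoint.\<close>

lemma lift_off_coset:
  assumes "(a - b) / t powi n \<notin> \<O>" "u \<in> \<O>"
  shows "lift \<nu> t res f b n (a + t powi n * u) = 0"
proof -
  have eq: "(a + t powi n * u - b) / t powi n = u + (a - b) / t powi n"
    by (simp add: field_simps)
  have "u + (a - b) / t powi n \<notin> \<O>"
    using assms vring_diff[of "u + (a - b) / t powi n" u] by auto
  then show ?thesis by (simp add: lift_def lift0_def eq)
qed

lemma lift_zero_outside: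
  assumes "(a - b) / t powi n \<in> \<O>" "(x - a) / t powi n \<notin> \<O>"
  shows "lift \<nu> t res f b n x = 0"
proof -
  have eq: "(x - a) / t powi n = (x - b) / t powi n - (a - b) / t powi n"
    by (simp add: field_simps)
  then have "(x - b) / t powi n \<notin> \<O>"
    using assms vring_diff by metis
  then show ?thesis by (simp add: lift_def lift0_def)
qed

text \<open>At the coarser level \<open>m\<close> the displacement becomes
  \<open>t powi (n - m) * u\<close>, which is integral with residue 0.\<close>

lemma lift_const_on_smaller_coset:
  assumes "m < n" "u \<in> \<O>"
  shows "lift \<nu> t res f b m (a + t powi n * u) = lift \<nu> t res f b m a"
proof -
  define w where "w = t powi (n - m) * u"
  have tw: "t powi (n - m) \<in> \<O>" using assms by (simp add: vring_powi)
  have w: "w \<in> \<O>" "res w = 0"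
    using assms tw by (simp_all add: w_def vring_mult res_mult res_powi_eq_0)
  have eq: "(a + t powi n * u - b) / t powi m = w + (a - b) / t powi m"
    by (simp add: w_def field_simps power_int_diff)
  have "w + (a - b) / t powi m \<in> \<O> \<longleftrightarrow> (a - b) / t powi m \<in> \<O>"
    using w vring_add vring_diff[of "w + (a - b) / t powi m" w] by auto
  then show ?thesis using w by (auto simp: lift_def lift0_def eq res_add)
qed

end

section \<open>Independence of the integral from the representing combination\<close>

locale two_dim_integral = residue_dvf \<nu> t res + haar_local_field \<mu>
  for \<nu> :: "'f::field \<Rightarrow> int" and t :: 'f and res :: "'f \<Rightarrow> 'k::{field, t2_space}"
    and \<mu> :: "'k measure"
begin

definition rep_fun :: "(CX \<times> ('k \<Rightarrow> complex) \<times> 'f \<times> int) list \<Rightarrow> 'f \<Rightarrow> CX" where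
  "rep_fun R x = (\<Sum>(r, f, a, n) \<leftarrow> R. r * cconst (lift \<nu> t res f a n x))"

lemma F_rep_iff: "F_rep \<nu> t res \<mu> g R \<longleftrightarrow> (\<forall>(r, f, a, n) \<in> set R. integrable \<mu> f) \<and> g = rep_fun R"
  by (simp add: F_rep_def rep_fun_def fun_eq_iff)

lemma sum_list_partition:
  "(\<Sum>x\<leftarrow>xs. g x) = (\<Sum>x\<leftarrow>filter P xs. g x) + (\<Sum>x\<leftarrow>filter (\<lambda>x. \<not> P x) xs. (g x :: 'b::comm_monoid_add))"
  by (induction xs) (auto simp: algebra_simps)

text \<open>On a coset of the deepest level occurring in \<open>R\<close>, the terms of \<open>R\<close> not attached to that coset
  are constant. The remaining ones add up to a constant integrable function of the residue, which
  vanishes because the measure is infinite; so they can be removed from \<open>R\<close>.\<close>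
lemma rep_val_zero:
  assumes "\<forall>(r, f, a, n) \<in> set R. integrable \<mu> f" "\<And>x. rep_fun R x = 0"
  shows "rep_val \<mu> R = 0"
  using assms
proof (induction R rule: length_induct)
  case (1 R)
  show ?case
  proof (cases "R = []")
    case True
    then show ?thesis by (simp add: rep_val_def)
  next
    case False
    define lev :: "CX \<times> ('k \<Rightarrow> complex) \<times> 'f \<times> int \<Rightarrow> int" where "lev = (\<lambda>(r, f, a, n). n)"
    define N where "N = Max (lev ` set R)"
    have "N \<in> lev ` set R" unfolding N_def using False by (intro Max_in) auto
    \<comment> \<open>The centre \<open>a\<close> comes from an actual entry of deepest level. This
      entry satisfies \<open>near\<close>, so \<open>Q\<close> is strictly shorter than
      \<open>R\<close> and the induction on length applies to it.\<close>
    then obtain r0 f0 a where e0: "(r0, f0, a, N) \<in> set R" by (auto simp: lev_def)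
    have le: "n \<le> N" if "(r, f, b, n) \<in> set R" for r f b n
      unfolding N_def using that by (intro Max_ge) (force simp: lev_def)+
    define near :: "CX \<times> ('k \<Rightarrow> complex) \<times> 'f \<times> int \<Rightarrow> bool"
      where "near = (\<lambda>(r, f, b, n). n = N \<and> (a - b) / t powi N \<in> \<O>)"
    define P where "P = filter near R"
    define Q where "Q = filter (\<lambda>x. \<not> near x) R"
    have split: "rep_fun R x = rep_fun P x + rep_fun Q x" for x
      unfolding rep_fun_def P_def Q_def by (rule sum_list_partition)
    have Qconst: "rep_fun Q (a + t powi N * u) = rep_fun Q a" if "u \<in> \<O>" for u
      unfolding rep_fun_def
    proof (intro arg_cong[where f=sum_list] map_cong refl, clarify)
      fix r f b n assume "(r, f, b, n) \<in> set Q"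
      then have mem: "(r, f, b, n) \<in> set R" and not: "n \<noteq> N \<or> (a - b) / t powi N \<notin> \<O>"
        by (auto simp: Q_def near_def)
      show "r * cconst (lift \<nu> t res f b n (a + t powi N * u)) = r * cconst (lift \<nu> t res f b n a)"
      proof (cases "n = N")
        case True
        then show ?thesis
          using not lift_off_coset[of a b n u f] lift_off_coset[of a b n 0 f] that by simp
      next
        case False
        then show ?thesis using le[OF mem] that by (simp add: lift_const_on_smaller_coset)
      qed
    qed
    \<comment> \<open>The shift \<open>sh b\<close> is the residue translation caused by using
      \<open>a\<close> as centre in place of \<open>b\<close>.\<close>
    define sh where "sh = (\<lambda>b. res ((a - b) / t powi N))"
    have P_on: "rep_fun P (a + t powi N * u) = (\<Sum>x\<leftarrow>P. fst x * cconst (fst (snd x) (res u + sh (fst (snd (snd x))))))"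
      if "u \<in> \<O>" for u
      unfolding rep_fun_def
    proof (intro arg_cong[where f=sum_list] map_cong refl, clarify)
      fix r f b n assume "(r, f, b, n) \<in> set P"
      then have "n = N" "(a - b) / t powi N \<in> \<O>"
        by (auto simp: P_def near_def)
      then show "r * cconst (lift \<nu> t res f b n (a + t powi N * u)) =
         fst (r, f, b, n) * cconst (fst (snd (r, f, b, n)) (res u + sh (fst (snd (snd (r, f, b, n))))))"
        using that by (simp add: lift_at_coset sh_def)
    qed
    define C where "C = - rep_fun Q a"
    have Psum: "(\<Sum>x\<leftarrow>P. fst x * cconst (fst (snd x) (v + sh (fst (snd (snd x)))))) = C" for v
    proof -
      obtain u where u: "u \<in> \<O>" "res u = v" using res_surj by blast
      have "rep_fun P (a + t powi N * u) + rep_fun Q (a + t powi N * u) = 0"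
        using split "1.prems"(2) by metis
      then show ?thesis using u by (simp add: P_on Qconst C_def eq_neg_iff_add_eq_0)
    qed
    have intP: "integrable \<mu> (\<lambda>v. fst (snd x) (v + sh (fst (snd (snd x)))))"
      and intP': "integrable \<mu> (fst (snd x))" if "x \<in> set P" for x
      using that "1.prems"(1) by (auto simp: P_def intro!: integrable_translate)
    have C0: "C = 0"
      and Pint: "(\<Sum>x\<leftarrow>P. fst x * cconst (LINT v|\<mu>. fst (snd x) (v + sh (fst (snd (snd x)))))) = 0"
      using integral_zero_if_const[OF intP Psum] by blast+
    \<comment> \<open>On the coset of \<open>a\<close> the sum is the constant \<open>C = 0\<close>,
      and off it every lift in \<open>P\<close> vanishes. Hence \<open>Q\<close> represents 0 as
      well.\<close>
    have P0: "rep_fun P x = 0" for x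
    proof (cases "(x - a) / t powi N \<in> \<O>")
      case True
      have "x = a + t powi N * ((x - a) / t powi N)" by simp
      then show ?thesis using P_on[OF True] Psum C0 by metis
    next
      case False
      then have "map (\<lambda>(r, f, b, n). r * cconst (lift \<nu> t res f b n x)) P = map (\<lambda>_. 0) P"
        by (intro map_cong refl) (auto simp: P_def near_def lift_zero_outside)
      then show ?thesis unfolding rep_fun_def by (simp only: sum_list_0)
    qed
    \<comment> \<open>Translation invariance removes the shifts; since all entries of
      \<open>P\<close> have level \<open>N\<close>, \<open>rep_val\<close> then differs from this
      sum only by the factor \<open>Xf powi N\<close>.\<close>
    have "(\<Sum>x\<leftarrow>P. fst x * cconst (LINT v|\<mu>. fst (snd x) v)) =
        (\<Sum>x\<leftarrow>P. fst x * cconst (LINT v|\<mu>. fst (snd x) (v + sh (fst (snd (snd x))))))"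
      by (intro arg_cong[where f=sum_list] map_cong refl) (simp only: integral_translate[OF intP'])
    with Pint have "(\<Sum>x\<leftarrow>P. fst x * cconst (LINT v|\<mu>. fst (snd x) v)) = 0" by simp
    moreover have "rep_val \<mu> P = (\<Sum>x\<leftarrow>P. fst x * cconst (LINT v|\<mu>. fst (snd x) v)) * Xf powi N"
      unfolding rep_val_def sum_list_mult_const[symmetric]
      by (intro arg_cong[where f=sum_list] map_cong refl) (auto simp: P_def near_def)
    ultimately have "rep_val \<mu> P = 0" by simp
    moreover have "rep_val \<mu> Q = 0"
    proof -
      have "length Q < length R"
        unfolding Q_def by (rule length_filter_less[OF e0]) (simp add: near_def)
      moreover have "\<forall>(r, f, a, n) \<in> set Q. integrable \<mu> f"
        using "1.prems"(1) by (auto simp: Q_def)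
      moreover have "rep_fun Q x = 0" for x
        using split[of x] P0[of x] "1.prems"(2)[of x] by simp
      ultimately show ?thesis using "1.IH" by blast
    qed
    moreover have "rep_val \<mu> R = rep_val \<mu> P + rep_val \<mu> Q"
      unfolding rep_val_def P_def Q_def by (rule sum_list_partition)
    ultimately show ?thesis by simp
  qed
qed

text \<open>Any representation of \<open>g\<close>, extended by the negative of the given lift,
  represents 0, so \<open>rep_val_zero\<close> forces its value. The scalar \<open>c\<close> covers
  both sections that vanish identically and the powers of \<open>Xf\<close> left by an inner
  integral.\<close>

lemma has_integral_lift:
  assumes "integrable \<mu> f" "\<And>x. g x = c * cconst (lift \<nu> t res f a n x)"
  shows "has_integral_F \<nu> t res \<mu> g (c * cconst (LINT u|\<mu>. f u) * Xf powi n)"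
  unfolding has_integral_F_def
proof (intro conjI allI impI exI)
  show "F_rep \<nu> t res \<mu> g [(c, f, a, n)]"
    using assms by (auto simp: F_rep_iff rep_fun_def)
  fix R assume R: "F_rep \<nu> t res \<mu> g R"
  define R' where "R' = (- c, f, a, n) # R"
  have "rep_fun R x = g x" for x using R by (simp add: F_rep_iff)
  then have "rep_fun R' x = 0" for x
    using assms(2)[of x] by (simp add: R'_def rep_fun_def)
  moreover have "\<forall>(r, f, a, n) \<in> set R'. integrable \<mu> f"
    using R assms(1) by (auto simp: R'_def F_rep_iff)
  ultimately have "rep_val \<mu> R' = 0" using rep_val_zero by blast
  moreover have "rep_val \<mu> R' = rep_val \<mu> R - c * cconst (LINT u|\<mu>. f u) * Xf powi n"
    unfolding R'_def rep_val_def
    by (simp only: list.map sum_list.Cons prod.case mult_minus_left add.commute[of "- _"] diff_conv_add_uminus)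
  ultimately show "rep_val \<mu> R = c * cconst (LINT u|\<mu>. f u) * Xf powi n"
    by (metis eq_iff_diff_eq_0)
qed

end

section \<open>Fubini on F\<close>

context two_dim_integral
begin

text \<open>The function \<open>p\<close> is the reduction of \<open>q\<close> modulo the maximal
  ideal, built by Horner's scheme; continuity is what the shear on \<open>K\<close> requires of
  it.\<close>

lemma poly_res:
  assumes "\<And>i. coeff q i \<in> \<O>"
  shows "\<exists>p. continuous_on UNIV p \<and> (\<forall>x\<in>\<O>. poly q x \<in> \<O> \<and> res (poly q x) = p (res x))"
  using assms
proof (induction q)
  case 0
  have "res 0 = 0" using res_eq_0_iff[of 0] by simp
  then show ?case by (intro exI[of _ "\<lambda>_. 0"]) simp
next
  case (pCons a q)
  have a: "a \<in> \<O>" using pCons.prems[of 0] by simp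
  have "coeff q i \<in> \<O>" for i using pCons.prems[of "Suc i"] by simp
  then obtain p where p: "continuous_on UNIV p"
      "\<And>x. x \<in> \<O> \<Longrightarrow> poly q x \<in> \<O> \<and> res (poly q x) = p (res x)"
    using pCons.IH by blast
  have "continuous_on UNIV (\<lambda>u. res a + u * p u)"
    using p(1) by (intro field_continuous_on_add field_continuous_on_mult continuous_on_const continuous_on_id)
  then show ?case
    using a p(2) by (intro exI[of _ "\<lambda>u. res a + u * p u"]) (simp add: vring_add vring_mult res_add res_mult)
qed

text \<open>Every section is a scalar times a single lift, and so is each inner integral as a
  function of the remaining variable. Thus \<open>has_integral_lift\<close> evaluates all four
  integrals, leaving an identity on \<open>K\<close>.\<close>

lemma fubini_F_shear:
  assumes q: "pcompose h [:a1, t powi n1:] = [:poly h a1:] + smult (t powi R') q"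
    and q_int: "\<And>i. coeff q i \<in> \<O>"
    and depth: "0 \<le> R' - n2"
    and SB: "schwartz_bruhat f"
  shows "fubini_F \<nu> t res \<mu>
           (\<lambda>x y. cconst (lift2 \<nu> t res f a1 a2 n1 n2 x (y - poly h x)))
           (cconst (LINT v|\<mu>. LINT u|\<mu>. f (u, v)) * Xf powi (n1 + n2))"
proof -
  obtain p0 where p0: "continuous_on UNIV p0"
      "\<And>x. x \<in> \<O> \<Longrightarrow> poly q x \<in> \<O> \<and> res (poly q x) = p0 (res x)"
    using poly_res[OF q_int] by blast
  \<comment> \<open>Non-negative depth makes \<open>s\<close> integral. At depth 0 it equals 1 and
    \<open>p\<close> is the reduction of \<open>q\<close>; at positive depth its residue is 0 and
    the shear on \<open>K\<close> is trivial.\<close>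
  define s where "s = t powi (R' - n2)"
  have s: "s \<in> \<O>" using depth by (simp add: s_def vring_powi)
  define p where "p = (\<lambda>u. res s * p0 u)"
  have p: "continuous_on UNIV p"
    unfolding p_def using p0(1) by (intro field_continuous_on_mult continuous_on_const)
  have sq: "s * poly q x \<in> \<O>" "res (s * poly q x) = p (res x)" if "x \<in> \<O>" for x
    using p0(2)[OF that] s by (simp_all add: p_def vring_mult res_mult)
  have fub: "fubini_on (\<lambda>u v. f (u, v))"
    using fubini_on_shear[OF SB, of "\<lambda>_. 0"] by simp
  have fub': "fubini_on (\<lambda>u v. f (u, v - p u))"
    using fubini_on_shear[OF SB p] .
  define b where "b = a2 + poly h a1"
  define G where "G u = (LINT v|\<mu>. f (u, v))" for u
  define G' where "G' v = (LINT u|\<mu>. f (u, v - p u))" for v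
  define I where "I = (LINT v|\<mu>. LINT u|\<mu>. f (u, v))"
  have int_f: "integrable \<mu> (\<lambda>v. f (u, v))" for u
    using fub by (simp add: fubini_on_def)
  have int_f': "integrable \<mu> (\<lambda>u. f (u, v - p u))" for v
    using fub' by (simp add: fubini_on_def)
  have int_G: "integrable \<mu> G" and int_G': "integrable \<mu> G'"
    using fub fub' by (simp_all add: fubini_on_def G_def[abs_def] G'_def[abs_def])
  have val_G: "(LINT u|\<mu>. G u) = I"
    using fub by (simp add: fubini_on_def G_def I_def)
  \<comment> \<open>Integrating over \<open>v\<close> first undoes the shear by translation. This
    links the two uses of Fubini on \<open>K\<close> and gives \<open>G'\<close> the same integral
    \<open>I\<close> as \<open>G\<close>.\<close>
  have "(LINT v|\<mu>. f (u, v - p u)) = G u" for u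
    using integral_translate[OF int_f, of u "- p u"] by (simp add: G_def)
  then have val_G': "(LINT v|\<mu>. G' v) = I"
    using fub' val_G by (simp add: fubini_on_def G'_def)
  define \<Phi> where "\<Phi> x y = cconst (lift2 \<nu> t res f a1 a2 n1 n2 x (y - poly h x))" for x y
  define Iy where "Iy x = Xf powi n2 * cconst (lift \<nu> t res G a1 n1 x)" for x
  define Ix where "Ix y = Xf powi n1 * cconst (lift \<nu> t res G' b n2 y)" for y
  have "has_integral_F \<nu> t res \<mu> (\<Phi> x) (Iy x)" for x
  proof -
    define x' where "x' = (x - a1) / t powi n1"
    \<comment> \<open>The section is zero unless \<open>x\<close> lies in the coset of
      \<open>a1\<close> at level \<open>n1\<close>; \<open>c\<close> records this.\<close>
    define c :: CX where "c = (if x' \<in> \<O> then 1 else 0)"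
    have "\<Phi> x y = c * cconst (lift \<nu> t res (\<lambda>v. f (res x', v)) (a2 + poly h x) n2 y)" for y
      by (simp add: \<Phi>_def lift2_def lift0_2_def lift_def lift0_def c_def x'_def[symmetric]
          diff_diff_eq add.commute)
    from has_integral_lift[OF int_f this] show ?thesis
      by (simp add: Iy_def lift_def lift0_def c_def x'_def[symmetric] G_def mult.commute split: if_splits)
  qed
  moreover have "has_integral_F \<nu> t res \<mu> (\<lambda>x. \<Phi> x y) (Ix y)" for y
  proof -
    define y' where "y' = (y - b) / t powi n2"
    define c :: CX where "c = (if y' \<in> \<O> then 1 else 0)"
    have "\<Phi> x y = c * cconst (lift \<nu> t res (\<lambda>u. f (u, res y' - p u)) a1 n1 x)" for x
    proof -
      define x' where "x' = (x - a1) / t powi n1"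
      have x: "x = a1 + t powi n1 * x'" by (simp add: x'_def)
      have "poly h x = poly (pcompose h [:a1, t powi n1:]) x'"
        by (simp add: poly_pcompose x mult.commute)
      also have "\<dots> = poly h a1 + t powi R' * poly q x'"
        by (simp add: q)
      finally have hx: "poly h x = poly h a1 + t powi R' * poly q x'" .
      have "(y - poly h x - a2) / t powi n2 = y' - s * poly q x'"
        by (simp add: hx y'_def b_def s_def field_simps power_int_diff)
      \<comment> \<open>As \<open>s * poly q x'\<close> is integral, the support condition on
        \<open>y\<close> no longer involves \<open>x\<close>. It can therefore be pulled out as the
        scalar \<open>c\<close>, and only residues of \<open>x'\<close> enter the lift.\<close>
      moreover have "y' - s * poly q x' \<in> \<O> \<longleftrightarrow> y' \<in> \<O>" if "x' \<in> \<O>"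
        using sq(1)[OF that] vring_diff vring_add[of "y' - s * poly q x'" "s * poly q x'"] by auto
      moreover have "res (y' - s * poly q x') = res y' - p (res x')" if "x' \<in> \<O>" "y' \<in> \<O>"
        using that sq res_diff by simp
      ultimately show ?thesis
        by (auto simp: \<Phi>_def lift2_def lift0_2_def lift_def lift0_def c_def x'_def[symmetric])
    qed
    from has_integral_lift[OF int_f' this] show ?thesis
      by (simp add: Ix_def lift_def lift0_def c_def y'_def[symmetric] G'_def mult.commute split: if_splits)
  qed
  moreover have "has_integral_F \<nu> t res \<mu> Iy (cconst I * Xf powi (n1 + n2))"
  proof -
    have "Xf \<noteq> 0" by (simp add: Xf_def Zero_fract_def eq_fract)
    then show ?thesis
      using has_integral_lift[OF int_G Iy_def] by (simp add: val_G power_int_add mult_ac)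
  qed
  moreover have "has_integral_F \<nu> t res \<mu> Ix (cconst I * Xf powi (n1 + n2))"
  proof -
    have "Xf \<noteq> 0" by (simp add: Xf_def Zero_fract_def eq_fract)
    then show ?thesis
      using has_integral_lift[OF int_G' Ix_def] by (simp add: val_G' power_int_add mult_ac)
  qed
  ultimately show ?thesis
    unfolding fubini_F_def I_def[symmetric] \<Phi>_def[symmetric] by blast
qed

end

theorem theorem5p5:
  fixes \<nu> :: "'f::field \<Rightarrow> int" and t :: 'f and res :: "'f \<Rightarrow> 'k::{field, t2_space}"
    and \<mu> :: "'k measure"
    and a1 a2 :: 'f and n1 n2 :: int and h :: "'f poly"
    and f :: "'k \<times> 'k \<Rightarrow> complex"
  assumes F: "cdvf \<nu> t res"
    and K: "local_field TYPE('k)"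
    and haar: "haar_measure \<mu>"
    and nonconst: "1 \<le> degree h"
    and depth: "\<exists>R' q. pcompose h [:a1, t powi n1:] = [:poly h a1:] + smult (t powi R') q \<and>
                      (\<forall>i. coeff q i \<in> vring \<nu>) \<and> (\<exists>i. res (coeff q i) \<noteq> 0) \<and>
                      0 \<le> R' - n2"
    and SB: "schwartz_bruhat f"
  shows "fubini_F \<nu> t res \<mu>
           (\<lambda>x y. cconst (lift2 \<nu> t res f a1 a2 n1 n2 x (y - poly h x)))
           (cconst (LINT v|\<mu>. LINT u|\<mu>. f (u, v)) * Xf powi (n1 + n2))"
proof -
  interpret two_dim_integral \<nu> t res \<mu>
    using F K haar by unfold_locales
  show ?thesis
    using depth fubini_F_shear SB by blast
qed

end
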